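(* Let $\lambda,a,b\in\mathbb{C}$ with $\lambda\neq0$ and $ab\neq-1$, and let $s\in\mathbb{C}$ satisfy $s^2=\frac{1}{ab+1}$. Define the following odd $4\times4$ complex matrices: $$T_3^\lambda=\lambda E_{13}+aE_{42},\quad T_2^\lambda=-\lambda E_{14}+aE_{32},\quad D_4^\lambda=\lambda E_{24}+aE_{31},\quad D_1^\lambda=-\lambda E_{23}+aE_{41},$$ $$T_1^\lambda=bE_{14}+\lambda^{-1}E_{32},\quad T_4^\lambda=bE_{13}-\lambda^{-1}E_{42},\quad D_2^\lambda=bE_{23}+\lambda^{-1}E_{41},\quad D_3^\lambda=bE_{24}-\lambda^{-1}E_{31}.$$ Then the linear map $\theta:\widehat{\mathfrak{psl}}(2|2)\to\mathfrak{gl}(2|2)$ given on the basis by $$\theta(\tilde C_{11})=sD_4^\lambda,\ \theta(\tilde C_{12})=sT_2^\lambda,\ \theta(\tilde C_{22})=sT_3^\lambda,\ \theta(\tilde C_{21})=sD_1^\lambda,$$ $$\theta(\tilde B_{11})=sT_4^\lambda,\ \theta(\tilde B_{12})=sT_1^\lambda,\ \theta(\tilde B_{22})=sD_3^\lambda,\ \theta(\tilde B_{21})=sD_2^\lambda,$$ $$\theta(\tilde E_1)=E_{12},\ \theta(\tilde F_1)=E_{21},\ \theta(\tilde H_1)=E_{11}-E_{22},\ \theta(\tilde E_2)=E_{43},\ \theta(\tilde F_2)=E_{34},\ \theta(\tilde H_2)=E_{33}-E_{44},$$ $$\theta(c)=\frac{s^2(ab-1)}{2}I_4,\quad \theta(c_+)=s^2\lambda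 a\,I_4,\quad \theta(c_-)=s^2\lambda^{-1}b\,I_4,$$ is an irreducible representation of the universal central extension $\widehat{\mathfrak{psl}}(2|2)$ on the $(2|2)$-dimensional complex superspace $\mathbb{C}^{2|2}$. This gives a three-parameter family of irreducible $(2|2)$-dimensional representations depending on $(\lambda,a,b)$.
   Context: $\mathfrak{gl}(2|2)$ denotes the Lie superalgebra of complex $4\times4$ matrices acting on $\mathbb{C}^{2|2}$, with basis vectors $1,2$ even and $3,4$ odd, with supercommutator bracket $[X,Y]=XY-(-1)^{p(X)p(Y)}YX$; $E_{kl}$ is the matrix unit at $(k,l)$ and $I_4$ the identity. $\mathfrak{sl}(2|2)$ consists of matrices $\begin{pmatrix}A&B\\ C&D\end{pmatrix}$ ($2\times2$ blocks) with $\mathrm{tr}A=\mathrm{tr}D$, and $\mathfrak{psl}(2|2)=\mathfrak{sl}(2|2)/\mathbb{C}I_4$. In $\mathfrak{psl}(2|2)$ let $\tilde E_1,\tilde F_1,\tilde H_1,\tilde E_2,\tilde F_2,\tilde H_2$ be the images of $E_{12},E_{21},E_{11}-E_{22},E_{43},E_{34},E_{33}-E_{44}$, and for $i,j\in\{1,2\}$ let $\tilde B_{ij}$ be the image of $E_{i,j+2}$ and $\tilde C_{ij}$ the image of $E_{i+2,j}$ (these 14 elements form a basis of $\mathfrak{psl}(2|2)$). The universal central extension is $\widehat{\mathfrak{psl}}(2|2)=\mathfrak{psl}(2|2)\oplus\mathrm{Span}(c_+,c,c_-)$ with $c,c_\pm$ even and central and bracket $[(g_1,x_1),(g_2,x_2)]=([g_1,g_2],f(g_1,g_2))$,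 where the 2-cocycle $f$ is supersymmetric on odd elements, vanishes if an argument is even, and on odd basis elements is given by $f(\tilde B_{12},\tilde C_{21})=f(\tilde C_{12},\tilde B_{21})=f(\tilde C_{22},\tilde B_{22})=f(\tilde B_{11},\tilde C_{11})=c$, $f(\tilde C_{22},\tilde C_{11})=-f(\tilde C_{12},\tilde C_{21})=c_+$, $f(\tilde B_{12},\tilde B_{21})=-f(\tilde B_{11},\tilde B_{22})=c_-$, and zero on all other pairs of basis elements (up to symmetry). An element $g\in\mathfrak{psl}(2|2)$ is identified with $(g,0)$. *)

theory Defs
  imports "HOL-Analysis.Analysis"
begin

text \<open>Vectors of C^(2|2) are complex^4, matrices are complex^4^4 (row index first).
  Basis indices 1,2 are even, 3,4 are odd.\<close>

definition odd_idx :: "4 \<Rightarrow> bool" where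
  "odd_idx i \<longleftrightarrow> i = 3 \<or> i = 4"

definition Emat :: "4 \<Rightarrow> 4 \<Rightarrow> complex^4^4" where
  "Emat k l = (\<chi> i j. if i = k \<and> j = l then 1 else 0)"

definition smat :: "complex \<Rightarrow> complex^4^4 \<Rightarrow> complex^4^4" where
  "smat c X = (\<chi> i j. c * X $ i $ j)"

definition even_part :: "complex^4^4 \<Rightarrow> complex^4^4" where
  "even_part X = (\<chi> i j. if odd_idx i = odd_idx j then X $ i $ j else 0)"

definition odd_part :: "complex^4^4 \<Rightarrow> complex^4^4" where
  "odd_part X = (\<chi> i j. if odd_idx i = odd_idx j then 0 else X $ i $ j)"

text \<open>Supercommutator on gl(2|2), extended bilinearly to non-homogeneous matrices.\<close>
definition sbr :: "complex^4^4 \<Rightarrow> complex^4^4 \<Rightarrow> complex^4^4" where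
  "sbr X Y = (let X0 = even_part X; X1 = odd_part X; Y0 = even_part Y; Y1 = odd_part Y in
      (X0 ** Y0 - Y0 ** X0) + (X0 ** Y1 - Y1 ** X0) + (X1 ** Y0 - Y0 ** X1)
      + (X1 ** Y1 + Y1 ** X1))"

definition homog_mat :: "bool \<Rightarrow> complex^4^4 \<Rightarrow> bool" where
  "homog_mat p X \<longleftrightarrow> (if p then even_part X = 0 else odd_part X = 0)"

definition even_vec :: "complex^4 \<Rightarrow> complex^4" where
  "even_vec v = (\<chi> i. if odd_idx i then 0 else v $ i)"

definition graded_subspace :: "(complex^4) set \<Rightarrow> bool" where
  "graded_subspace W \<longleftrightarrow> vec.subspace W \<and> (\<forall>v\<in>W. even_vec v \<in> W)"

datatype pbasis = bE1 | bF1 | bH1 | bE2 | bF2 | bH2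
  | bB11 | bB12 | bB21 | bB22 | bC11 | bC12 | bC21 | bC22
  | cc | cplus | cminus

lemma UNIV_pbasis: "(UNIV :: pbasis set) = {bE1, bF1, bH1, bE2, bF2, bH2,
  bB11, bB12, bB21, bB22, bC11, bC12, bC21, bC22, cc, cplus, cminus}"
  by (auto intro: pbasis.exhaust)

instance pbasis :: finite
  by standard (simp add: UNIV_pbasis)

definition is_central :: "pbasis \<Rightarrow> bool" where
  "is_central x \<longleftrightarrow> x \<in> {cc, cplus, cminus}"

definition is_odd :: "pbasis \<Rightarrow> bool" where
  "is_odd x \<longleftrightarrow> x \<in> {bB11, bB12, bB21, bB22, bC11, bC12, bC21, bC22}"

text \<open>Representative matrices in sl(2|2) of the basis of psl(2|2).\<close>
fun rep :: "pbasis \<Rightarrow> complex^4^4" where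
  "rep bE1 = Emat 1 2"
| "rep bF1 = Emat 2 1"
| "rep bH1 = Emat 1 1 - Emat 2 2"
| "rep bE2 = Emat 4 3"
| "rep bF2 = Emat 3 4"
| "rep bH2 = Emat 3 3 - Emat 4 4"
| "rep bB11 = Emat 1 3"
| "rep bB12 = Emat 1 4"
| "rep bB21 = Emat 2 3"
| "rep bB22 = Emat 2 4"
| "rep bC11 = Emat 3 1"
| "rep bC12 = Emat 3 2"
| "rep bC21 = Emat 4 1"
| "rep bC22 = Emat 4 2"
| "rep cc = 0"
| "rep cplus = 0"
| "rep cminus = 0"

text \<open>Coordinates in the basis of psl(2|2) of (the image of) a matrix in sl(2|2):
  a diagonal matrix diag(d1,d2,d3,d4) with d1+d2=d3+d4 equals
  (d1-d2)/2 H1 + (d3-d4)/2 H2 + (d1+d2)/2 I.\<close>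
definition coords :: "complex^4^4 \<Rightarrow> pbasis \<Rightarrow> complex" where
  "coords M x = (case x of
      bE1 \<Rightarrow> M $ 1 $ 2 | bF1 \<Rightarrow> M $ 2 $ 1 | bH1 \<Rightarrow> (M $ 1 $ 1 - M $ 2 $ 2) / 2
    | bE2 \<Rightarrow> M $ 4 $ 3 | bF2 \<Rightarrow> M $ 3 $ 4 | bH2 \<Rightarrow> (M $ 3 $ 3 - M $ 4 $ 4) / 2
    | bB11 \<Rightarrow> M $ 1 $ 3 | bB12 \<Rightarrow> M $ 1 $ 4 | bB21 \<Rightarrow> M $ 2 $ 3 | bB22 \<Rightarrow> M $ 2 $ 4
    | bC11 \<Rightarrow> M $ 3 $ 1 | bC12 \<Rightarrow> M $ 3 $ 2 | bC21 \<Rightarrow> M $ 4 $ 1 | bC22 \<Rightarrow> M $ 4 $ 2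
    | cc \<Rightarrow> 0 | cplus \<Rightarrow> 0 | cminus \<Rightarrow> 0)"

definition unitv :: "pbasis \<Rightarrow> pbasis \<Rightarrow> complex" where
  "unitv b = (\<lambda>b'. if b' = b then 1 else 0)"

fun cocyc0 :: "pbasis \<Rightarrow> pbasis \<Rightarrow> pbasis \<Rightarrow> complex" where
  "cocyc0 bB12 bC21 = unitv cc"
| "cocyc0 bC12 bB21 = unitv cc"
| "cocyc0 bC22 bB22 = unitv cc"
| "cocyc0 bB11 bC11 = unitv cc"
| "cocyc0 bC22 bC11 = unitv cplus"
| "cocyc0 bC12 bC21 = (\<lambda>k. - unitv cplus k)"
| "cocyc0 bB12 bB21 = unitv cminus"
| "cocyc0 bB11 bB22 = (\<lambda>k. - unitv cminus k)"
| "cocyc0 _ _ = (\<lambda>k. 0)"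

text \<open>The supersymmetric cocycle f (all listed pairs are distinct and appear in one order only).\<close>
definition cocyc :: "pbasis \<Rightarrow> pbasis \<Rightarrow> pbasis \<Rightarrow> complex" where
  "cocyc x y = (\<lambda>k. cocyc0 x y k + cocyc0 y x k)"

definition bbr :: "pbasis \<Rightarrow> pbasis \<Rightarrow> pbasis \<Rightarrow> complex" where
  "bbr x y = (\<lambda>k. if is_central x \<or> is_central y then 0
              else coords (sbr (rep x) (rep y)) k + cocyc x y k)"

text \<open>Elements of the central extension are coordinate vectors pbasis => complex;
  the bracket is the bilinear extension of the basis bracket.\<close>
definition hbr :: "(pbasis \<Rightarrow> complex) \<Rightarrow> (pbasis \<Rightarrow> complex) \<Rightarrow> pbasis \<Rightarrow> complex" where
  "hbr u v = (\<lambda>k. \<Sum>x\<in>UNIV. \<Sum>y\<in>UNIV. u x * v y * bbr x y k)"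

definition thetab :: "complex \<Rightarrow> complex \<Rightarrow> complex \<Rightarrow> complex \<Rightarrow> pbasis \<Rightarrow> complex^4^4" where
  "thetab lam a b s x = (let li = inverse lam;
      T3 = smat lam (Emat 1 3) + smat a (Emat 4 2);
      T2 = smat (- lam) (Emat 1 4) + smat a (Emat 3 2);
      D4 = smat lam (Emat 2 4) + smat a (Emat 3 1);
      D1 = smat (- lam) (Emat 2 3) + smat a (Emat 4 1);
      T1 = smat b (Emat 1 4) + smat li (Emat 3 2);
      T4 = smat b (Emat 1 3) - smat li (Emat 4 2);
      D2 = smat b (Emat 2 3) + smat li (Emat 4 1);
      D3 = smat b (Emat 2 4) - smat li (Emat 3 1) in
    (case x of
      bC11 \<Rightarrow> smat s D4 | bC12 \<Rightarrow> smat s T2 | bC22 \<Rightarrow> smat s T3 | bC21 \<Rightarrow> smat s D1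
    | bB11 \<Rightarrow> smat s T4 | bB12 \<Rightarrow> smat s T1 | bB22 \<Rightarrow> smat s D3 | bB21 \<Rightarrow> smat s D2
    | bE1 \<Rightarrow> Emat 1 2 | bF1 \<Rightarrow> Emat 2 1 | bH1 \<Rightarrow> Emat 1 1 - Emat 2 2
    | bE2 \<Rightarrow> Emat 4 3 | bF2 \<Rightarrow> Emat 3 4 | bH2 \<Rightarrow> Emat 3 3 - Emat 4 4
    | cc \<Rightarrow> smat (s^2 * (a * b - 1) / 2) (mat 1)
    | cplus \<Rightarrow> smat (s^2 * lam * a) (mat 1)
    | cminus \<Rightarrow> smat (s^2 * li * b) (mat 1)))"

definition lin_ext :: "(pbasis \<Rightarrow> complex^4^4) \<Rightarrow> (pbasis \<Rightarrow> complex) \<Rightarrow> complex^4^4" where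
  "lin_ext f u = (\<Sum>x\<in>UNIV. smat (u x) (f x))"

definition is_representation :: "((pbasis \<Rightarrow> complex) \<Rightarrow> complex^4^4) \<Rightarrow> bool" where
  "is_representation \<theta> \<longleftrightarrow>
     (\<forall>x. homog_mat (is_odd x) (\<theta> (unitv x))) \<and>
     (\<forall>u v. \<theta> (hbr u v) = sbr (\<theta> u) (\<theta> v))"

definition is_irreducible :: "((pbasis \<Rightarrow> complex) \<Rightarrow> complex^4^4) \<Rightarrow> bool" where
  "is_irreducible \<theta> \<longleftrightarrow>
     (\<forall>W. graded_subspace W \<and> (\<forall>u. \<forall>v\<in>W. \<theta> u *v v \<in> W) \<longrightarrow> W = {0} \<or> W = UNIV)"

end

theory Submission
  imports Defs
begin

text \<open>By bilinearity, the homomorphism property reduces to pairs of basis elements, where it is a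
  comparison of matrix entries that uses only \<open>s\<^sup>2 (a b + 1) = 1\<close>. For irreducibility, the images
  of \<open>E\<^sub>i\<close> and \<open>F\<^sub>i\<close> turn any vector with a nonzero coordinate into a basis vector of the
  same parity, and then \<open>B\<^sub>2\<^sub>2\<close> (coefficient \<open>- s / \<lambda>\<close>) and \<open>C\<^sub>2\<^sub>2\<close> (coefficient
  \<open>s \<lambda>\<close>) exchange the two parities. These coefficients do not vanish even when \<open>a\<close> or \<open>b\<close>
  does.\<close>

lemma smat_nth [simp]: "smat c X $ i $ j = c * X $ i $ j"
  by (simp add: smat_def)

lemma Emat_nth: "Emat k l $ i $ j = (if i = k \<and> j = l then 1 else 0)"
  by (simp add: Emat_def)

lemma even_part_nth: "even_part X $ i $ j = (if odd_idx i = odd_idx j then X $ i $ j else 0)"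
  by (simp add: even_part_def)

lemma odd_part_nth: "odd_part X $ i $ j = (if odd_idx i = odd_idx j then 0 else X $ i $ j)"
  by (simp add: odd_part_def)

text \<open>The entry at \<open>(i, k)\<close> lies in the odd part exactly when \<open>i\<close>
  and \<open>k\<close> differ in parity, so the sign rule for two odd factors can be read off from
  the indices. Bracket identities become identities of finite sums.\<close>

lemma sbr_nth:
  "sbr X Y $ i $ j = (\<Sum>k\<in>UNIV. X $ i $ k * Y $ k $ j
     - (if odd_idx i \<noteq> odd_idx k \<and> odd_idx k \<noteq> odd_idx j then -1 else 1) * (Y $ i $ k * X $ k $ j))"
  unfolding sbr_def Let_def
  by (simp add: matrix_matrix_mult_def even_part_nth odd_part_nth
      flip: sum.distrib sum_subtractf, rule sum.cong) auto

lemma sbr_sum_left: "sbr (\<Sum>x\<in>A. f x) Y = (\<Sum>x\<in>A. sbr (f x) Y)"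
proof (induction A rule: infinite_finite_induct)
  case (insert x A)
  have "sbr (X + X') Y = sbr X Y + sbr X' Y" for X X'
    by (simp add: vec_eq_iff sbr_nth algebra_simps flip: sum.distrib)
  with insert show ?case by simp
qed (simp_all add: vec_eq_iff sbr_nth)

lemma sbr_sum_right: "sbr X (\<Sum>y\<in>A. f y) = (\<Sum>y\<in>A. sbr X (f y))"
proof (induction A rule: infinite_finite_induct)
  case (insert y A)
  have "sbr X (Y + Y') = sbr X Y + sbr X Y'" for Y Y'
    by (simp add: vec_eq_iff sbr_nth algebra_simps flip: sum.distrib)
  with insert show ?case by simp
qed (simp_all add: vec_eq_iff sbr_nth)

lemma sbr_smat_left: "sbr (smat c X) Y = smat c (sbr X Y)"
  by (simp add: vec_eq_iff sbr_nth sum_distrib_left algebra_simps)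

lemma sbr_smat_right: "sbr X (smat c Y) = smat c (sbr X Y)"
  by (simp add: vec_eq_iff sbr_nth sum_distrib_left algebra_simps)

lemma lin_ext_nth: "lin_ext f u $ i $ j = (\<Sum>x\<in>UNIV. u x * f x $ i $ j)"
  by (simp add: lin_ext_def sum_component)

lemma lin_ext_unitv [simp]: "lin_ext f (unitv x) = f x"
  by (simp add: vec_eq_iff lin_ext_nth unitv_def if_distrib[of "\<lambda>c. c * _"] cong: if_cong)

lemma lin_ext_hbr:
  assumes "\<And>x y. lin_ext f (bbr x y) = sbr (f x) (f y)"
  shows "lin_ext f (hbr u v) = sbr (lin_ext f u) (lin_ext f v)"
proof -
  have "lin_ext f (hbr u v) = (\<Sum>x\<in>UNIV. \<Sum>y\<in>UNIV. smat (u x * v y) (lin_ext f (bbr x y)))"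
    unfolding vec_eq_iff hbr_def lin_ext_nth sum_component smat_nth
      sum_distrib_left sum_distrib_right
    \<comment> \<open>The two swaps move the sum over the coordinates of the bracket inside the sums
      over \<open>x\<close> and \<open>y\<close>.\<close>
    by (intro allI, subst sum.swap, rule sum.cong[OF refl], subst sum.swap)
      (simp add: mult.assoc)
  also have "\<dots> = sbr (lin_ext f u) (lin_ext f v)"
    unfolding assms
    by (simp add: lin_ext_def sbr_sum_left sbr_sum_right sbr_smat_left sbr_smat_right)
      (subst sum.swap, simp add: vec_eq_iff sum_distrib_left mult.assoc mult.left_commute)
  finally show ?thesis .
qed

text \<open>A scalar matrix is even, so the bracket with it is an ordinary commutator and vanishes.
  This settles all pairs with a central element, whose images are scalar.\<close>

lemma sbr_scalar_left: "sbr (smat c (mat 1)) Y = 0"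
  by (simp add: vec_eq_iff sbr_nth mat_def sum_subtractf sum.delta
      if_distrib[of "\<lambda>d. d * _"] if_distrib[of "\<lambda>d. _ * d"] cong: if_cong)

lemma sbr_scalar_right: "sbr X (smat c (mat 1)) = 0"
  by (simp add: vec_eq_iff sbr_nth mat_def sum_subtractf sum.delta
      if_distrib[of "\<lambda>d. d * _"] if_distrib[of "\<lambda>d. _ * d"] cong: if_cong)

lemma lin_ext_thetab_bbr:
  fixes lam a b s :: complex
  assumes "lam \<noteq> 0" and "s\<^sup>2 * (a * b + 1) = 1"
  shows "lin_ext (thetab lam a b s) (bbr x y) = sbr (thetab lam a b s x) (thetab lam a b s y)"
proof (cases "is_central x \<or> is_central y")
  case True
  moreover have "lin_ext (thetab lam a b s) (\<lambda>k. 0) = 0"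
    by (simp add: vec_eq_iff lin_ext_nth)
  ultimately show ?thesis
    by (auto simp: bbr_def is_central_def thetab_def sbr_scalar_left sbr_scalar_right)
next
  case False
  \<comment> \<open>Up to sign, the entries of the odd images are \<open>s * lam\<close>,
    \<open>s / lam\<close>, \<open>s * a\<close> and \<open>s * b\<close>. These rules reduce their
    products in anticommutators to polynomials in \<open>s * s\<close>.\<close>
  have li: "s * lam * (s * inverse lam) = s * s" "s * inverse lam * (s * lam) = s * s"
    using assms(1) by simp_all
  have ab: "s * b * (s * a) = 1 - s * s" "s * a * (s * b) = 1 - s * s" "s * s * (a * b) = 1 - s * s"
    using assms(2) by (simp_all add: power2_eq_square algebra_simps)
  \<comment> \<open>This is the scalar of \<theta>(c). The 1/2 restores the multiple of the identity
    that \<open>coords\<close> drops, as in [E_13, E_31] = (H_1 + H_2 + I)/2.\<close>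
  then have half: "s * s * (a * b - 1) / 2 = 1 / 2 - s * s"
    by (simp add: right_diff_distrib diff_divide_distrib)
  from False show ?thesis
    by (cases x; cases y; simp add: assms(1) vec_eq_iff forall_4 lin_ext_nth UNIV_pbasis bbr_def
          is_central_def coords_def cocyc_def unitv_def sbr_nth sum_4 odd_idx_def Emat_nth
          thetab_def mat_def)
      (simp_all add: power2_eq_square li ab half)
qed

lemma homog_thetab: "homog_mat (is_odd x) (thetab lam a b s x)"
  by (cases x; simp add: homog_mat_def is_odd_def vec_eq_iff forall_4 even_part_nth odd_part_nth
      odd_idx_def thetab_def Emat_nth mat_def)

lemma Emat_mult_vec [simp]: "Emat k l *v v = v $ l *s axis k 1"
  by (simp add: vec_eq_iff matrix_vector_mult_def Emat_nth axis_def
      if_distrib[of "\<lambda>c. c * _"] cong: if_cong)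

lemma smat_mult_vec [simp]: "smat c X *v v = c *s (X *v v)"
  by (simp add: vec_eq_iff matrix_vector_mult_def sum_distrib_left mult.assoc)

text \<open>Strips the nonzero coefficient left when a matrix unit sends a vector to a multiple of a
  basis vector.\<close>

lemma subspace_scale_iff:
  fixes W :: "(complex^4) set"
  assumes "vec.subspace W" "c \<noteq> 0"
  shows "c *s v \<in> W \<longleftrightarrow> v \<in> W"
proof
  assume "c *s v \<in> W"
  then have "inverse c *s (c *s v) \<in> W"
    by (rule vec.subspace_scale[OF assms(1)])
  then show "v \<in> W"
    using assms(2) by (simp add: vector_smult_assoc)
qed (rule vec.subspace_scale[OF assms(1)])

lemma irreducible_thetab:
  assumes "lam \<noteq> 0" "s \<noteq> 0"
  shows "is_irreducible (lin_ext (thetab lam a b s))"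
  unfolding is_irreducible_def
proof (intro allI impI)
  fix W :: "(complex^4) set"
  assume "graded_subspace W \<and> (\<forall>u. \<forall>v\<in>W. lin_ext (thetab lam a b s) u *v v \<in> W)"
  then have sub: "vec.subspace W"
    and inv: "\<And>u v. v \<in> W \<Longrightarrow> lin_ext (thetab lam a b s) u *v v \<in> W"
    by (auto simp: graded_subspace_def)
  have act: "thetab lam a b s x *v v \<in> W" if "v \<in> W" for x v
    using inv[OF that, of "unitv x"] by simp
  note scale = subspace_scale_iff[OF sub]
  have E1: "axis 1 1 \<in> W" if "v \<in> W" "v $ 2 \<noteq> 0" for v
    using act[OF that(1), of bE1] that(2) by (simp add: thetab_def scale)
  have F1: "axis 2 1 \<in> W" if "v \<in> W" "v $ 1 \<noteq> 0" for v
    using act[OF that(1), of bF1] that(2) by (simp add: thetab_def scale)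
  have E2: "axis 4 1 \<in> W" if "v \<in> W" "v $ 3 \<noteq> 0" for v
    using act[OF that(1), of bE2] that(2) by (simp add: thetab_def scale)
  have F2: "axis 3 1 \<in> W" if "v \<in> W" "v $ 4 \<noteq> 0" for v
    using act[OF that(1), of bF2] that(2) by (simp add: thetab_def scale)
  have even: "axis 1 1 \<in> W \<longleftrightarrow> axis 2 1 \<in> W"
    using E1[of "axis 2 1"] F1[of "axis 1 1"] by auto
  have odd: "axis 3 1 \<in> W \<longleftrightarrow> axis 4 1 \<in> W"
    using E2[of "axis 3 1"] F2[of "axis 4 1"] by auto
  \<comment> \<open>In s (b E_24 - E_31 / lam) the first term kills e_1, leaving -(s / lam) e_3;
    negation removes the sign.\<close>
  have even_odd: "axis 3 1 \<in> W" if "axis 1 1 \<in> W"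
    using vec.subspace_neg[OF sub act[OF that, of bB22]] assms
    by (simp add: thetab_def matrix_vector_mult_diff_rdistrib scale axis_def[of "1::4"])
  \<comment> \<open>In s (lam E_13 + a E_42) the second term kills e_3, leaving s lam e_1.\<close>
  have odd_even: "axis 1 1 \<in> W" if "axis 3 1 \<in> W"
    using act[OF that, of bC22] assms
    by (simp add: thetab_def matrix_vector_mult_add_rdistrib scale axis_def[of "3::4"])
  show "W = {0} \<or> W = UNIV"
  proof (cases "W \<subseteq> {0}")
    case True
    then show ?thesis
      using vec.subspace_0[OF sub] by auto
  next
    case False
    then obtain w where "w \<in> W" "w \<noteq> 0" by auto
    then have "w $ 1 \<noteq> 0 \<or> w $ 2 \<noteq> 0 \<or> w $ 3 \<noteq> 0 \<or> w $ 4 \<noteq> 0"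
      by (auto simp: vec_eq_iff forall_4)
    \<comment> \<open>A nonzero coordinate yields one basis vector, and the links within and between
      the parities reach the other three.\<close>
    then have "\<forall>i. axis i 1 \<in> W"
      using E1 F1 E2 F2 even odd even_odd odd_even \<open>w \<in> W\<close> unfolding forall_4 by metis
    then have "(\<Sum>i\<in>UNIV. v $ i *s axis i 1) \<in> W" for v
      by (intro vec.subspace_sum[OF sub] vec.subspace_scale[OF sub]) simp
    then show ?thesis
      by (auto simp: basis_expansion)
  qed
qed

theorem theorem4p4:
  fixes lam a b s :: complex
  assumes "lam \<noteq> 0" and "a * b \<noteq> -1" and "s^2 = 1 / (a * b + 1)"
  shows "is_representation (lin_ext (thetab lam a b s))
       \<and> is_irreducible (lin_ext (thetab lam a b s))"
proof -
  have "a * b + 1 \<noteq> 0"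
    using assms(2) by (simp add: eq_neg_iff_add_eq_0)
  \<comment> \<open>Clearing the denominator gives the relation behind the bracket computation; it
    also excludes \<open>s = 0\<close>, as irreducibility requires.\<close>
  with assms(3) have s: "s\<^sup>2 * (a * b + 1) = 1" by simp
  then have "s \<noteq> 0" by auto
  with assms(1) s show ?thesis
    by (simp add: is_representation_def homog_thetab lin_ext_hbr lin_ext_thetab_bbr irreducible_thetab)
qed

end
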